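(* Let $d\in\mathbb{N}$, and let $\mu$ be a probability measure on $\mathbb{R}^{d}$ with a continuous nonvanishing log-concave density function $f$. Then $$\lim_{\delta\rightarrow0}d_{\mathfrak{L}}(F_{\delta},D_{\delta})=1\qquad\text{and}\qquad \lim_{\delta\rightarrow0}d_{\mathfrak{L}}(F_{\delta},R_{\delta})=1.$$
   Context: A density $f$ on $\mathbb{R}^d$ is log-concave if $f=e^{-g}$ with $g$ convex. For $x\in\mathbb{R}^d$ let $\widetilde{f}(x)=\inf_{\mathfrak{H}}\mu(\mathfrak{H})$, where $\mathfrak{H}$ runs through all open half-spaces containing $x$, and let $f^{\sharp}(x)=\inf_{\mathcal{H}}\int_{\mathcal{H}}f(y)\,d_{\mathcal{H}}(y)$, where $\mathcal{H}$ runs through all hyperplanes (affine subspaces of dimension $d-1$) containing $x$ and $d_{\mathcal{H}}$ is ($(d-1)$-dimensional) Lebesgue measure on $\mathcal{H}$. For $\delta>0$ define $$F_{\delta}=\{x\in\mathbb{R}^{d}:\widetilde{f}(x)\geq\delta\},\quad D_{\delta}=\operatorname{Cl}\{x\in\mathbb{R}^{d}:f(x)\geq\delta\},\quad R_{\delta}=\operatorname{Cl}\{x\in\mathbb{R}^{d}:f^{\sharp}(x)\geq\delta\},$$ where $\operatorname{Cl}$ denotes closure. Logarithmic Hausdorff distance between convex bodies $K,L\subset\mathbb{R}^d$: $$d_{\mathfrak{L}}(K,L)=\inf\{\lambda\geq1:\exists x\in\operatorname{int}(K\cap L),\ \lambda^{-1}(L-x)+x\subset K\subset\lambda(L-x)+x\},$$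 with $\inf(\varnothing)=\infty$. *)

theory Defs
  imports "HOL-Probability.Probability"
begin

text \<open>
  A convex \<open>g\<close> may take the value \<open>+\<infinity>\<close> here, so that a log-concave \<open>f = exp (- g)\<close> may vanish;
  \<open>S\<close> is the set where \<open>g\<close> is finite.
\<close>

definition log_concave :: "('a::real_vector \<Rightarrow> real) \<Rightarrow> bool" where
  "log_concave f \<longleftrightarrow>
     (\<exists>S g. convex S \<and> convex_on S g \<and> f = (\<lambda>x. if x \<in> S then exp (- g x) else 0))"

definition open_halfspaces :: "'a::euclidean_space set set" where
  "open_halfspaces = {{y. a \<bullet> y < b} | a b. a \<noteq> 0}"

definition hyperplanes :: "'a::euclidean_space set set" where
  "hyperplanes = {H. affine H \<and> aff_dim H = int DIM('a) - 1}"

definition orthonormal_basis_of :: "'a::euclidean_space set \<Rightarrow> 'a set \<Rightarrow> bool" where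
  "orthonormal_basis_of V B \<longleftrightarrow> pairwise orthogonal B \<and> (\<forall>b\<in>B. norm b = 1) \<and> span B = V"

text \<open>
  Lebesgue measure of dimension \<open>aff_dim H\<close> on a nonempty affine subspace \<open>H\<close>, as a Borel
  measure on the ambient space: the image of product Lebesgue measure under the coordinates given
  by an origin \<open>p \<in> H\<close> and an orthonormal basis \<open>B\<close> of the direction space of \<open>H\<close> (compare
  the definition of \<^const>\<open>lborel\<close>). The measure does not depend on the choice of \<open>p\<close> and \<open>B\<close>,
  as Lebesgue measure is invariant under isometries. If \<open>H = {p}\<close> then \<open>B = {}\<close> and this is the
  unit mass at \<open>p\<close>.
\<close>

definition affine_lborel :: "'a::euclidean_space set \<Rightarrow> 'a measure" where
  "affine_lborel H =
     (let p = (SOME p. p \<in> H);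
          B = (SOME B. orthonormal_basis_of {y - p | y. y \<in> H} B)
      in distr (\<Pi>\<^sub>M b\<in>B. lborel) borel (\<lambda>c. p + (\<Sum>b\<in>B. c b *\<^sub>R b)))"

definition halfspace_depth :: "'a::euclidean_space measure \<Rightarrow> 'a \<Rightarrow> real" where
  "halfspace_depth M x = (INF H\<in>{H \<in> open_halfspaces. x \<in> H}. measure M H)"

definition hyperplane_depth :: "('a::euclidean_space \<Rightarrow> real) \<Rightarrow> 'a \<Rightarrow> ennreal" where
  "hyperplane_depth f x =
     (INF H\<in>{H \<in> hyperplanes. x \<in> H}. \<integral>\<^sup>+ y. ennreal (f y) \<partial>affine_lborel H)"

definition F_set :: "'a::euclidean_space measure \<Rightarrow> real \<Rightarrow> 'a set" where
  "F_set M \<delta> = {x. halfspace_depth M x \<ge> \<delta>}"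

definition D_set :: "('a::euclidean_space \<Rightarrow> real) \<Rightarrow> real \<Rightarrow> 'a set" where
  "D_set f \<delta> = closure {x. f x \<ge> \<delta>}"

definition R_set :: "('a::euclidean_space \<Rightarrow> real) \<Rightarrow> real \<Rightarrow> 'a set" where
  "R_set f \<delta> = closure {x. hyperplane_depth f x \<ge> ennreal \<delta>}"

text \<open>The infimum is taken in \<^typ>\<open>ereal\<close>, where the infimum of the empty set is \<open>\<infinity>\<close>.\<close>

definition log_hausdorff_dist :: "'a::euclidean_space set \<Rightarrow> 'a set \<Rightarrow> ereal" where
  "log_hausdorff_dist K L =
     Inf {ereal l | l. l \<ge> 1 \<and> (\<exists>x \<in> interior (K \<inter> L).
            (\<lambda>y. inverse l *\<^sub>R (y - x) + x) ` L \<subseteq> K \<and> K \<subseteq> (\<lambda>y. l *\<^sub>R (y - x) + x) ` L)}"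

end

theory Submission
  imports Defs
begin

text \<open>
  Write \<open>f = exp (- g)\<close> with \<open>g\<close> convex and \<open>t = - ln \<delta>\<close>, so that \<open>D_set f \<delta>\<close> is the sublevel
  set \<open>{x. g x \<le> t}\<close>, and let \<open>lam > 1\<close>. Every set in question turns out to lie between the
  dilates of this sublevel set by \<open>1 / lam\<close> and by \<open>lam\<close> about the origin once \<open>t\<close> is large. Two
  sets between these dilates have logarithmic Hausdorff distance at most \<open>lam\<^sup>2\<close>, and \<open>lam\<close> was
  arbitrary. Any centre works, because its potential is negligible against \<open>t\<close>.

  Suppose first that \<open>x\<close> lies in the small dilate. Then convexity bounds \<open>g\<close> by \<open>t / lam\<close> plus a
  constant on a ball around \<open>x\<close> whose radius depends only on \<open>lam\<close>
  (\<open>integral_near_point\<close>). Every hyperplane through \<open>x\<close> passes through the centre of this ball and every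
  half-space containing \<open>x\<close> contains a ball of half that radius, so both depths are at least
  \<open>c * exp (- t / lam)\<close>, which exceeds \<open>\<delta> = exp (- t)\<close> for large \<open>t\<close>.

  Suppose now that \<open>x\<close> lies outside the large dilate. Some hyperplane through \<open>x\<close> and some
  open half-space containing \<open>x\<close> avoid this closed convex set, and by convexity \<open>g\<close> exceeds
  \<open>lam * t\<close> minus a constant there. Integrability of \<open>f\<close> forces \<open>g\<close> to grow at least linearly
  (\<open>linear_growth\<close>), and the integral of \<open>exp (- \<alpha> * norm y)\<close> over an affine subspace is bounded
  uniformly in the subspace (\<open>nn_integral_exp_norm_bound\<close>). Hence both depths are at most
  \<open>C * exp (- \<kappa> * t)\<close> for some \<open>\<kappa> > 1\<close> (\<open>integral_outside_dilated_sublevel\<close>), which is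
  below \<open>\<delta>\<close> for large \<open>t\<close>.
\<close>

section \<open>Lebesgue measure in orthonormal coordinates\<close>

text \<open>
  The origin and the basis are explicit here, so that hyperplanes and, with the standard basis, the
  whole space fall under the same estimates.
\<close>

definition coordinate_lborel :: "'a::euclidean_space \<Rightarrow> 'a set \<Rightarrow> 'a measure" where
  "coordinate_lborel p B = distr (\<Pi>\<^sub>M b\<in>B. lborel) borel (\<lambda>c. p + (\<Sum>b\<in>B. c b *\<^sub>R b))"

definition orthonormal :: "'a::euclidean_space set \<Rightarrow> bool" where
  "orthonormal B \<longleftrightarrow> pairwise orthogonal B \<and> (\<forall>b\<in>B. norm b = 1)"

lemma orthonormal_Basis: "orthonormal (Basis :: 'a::euclidean_space set)"
  by (auto simp: orthonormal_def pairwise_def orthogonal_def inner_not_same_Basis)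

lemma orthonormal_finite_card:
  fixes B :: "'a::euclidean_space set"
  assumes "orthonormal B"
  shows "finite B" "card B \<le> DIM('a)"
proof -
  have "0 \<notin> B" using assms by (auto simp: orthonormal_def)
  hence "independent B"
    using assms by (simp add: orthonormal_def pairwise_orthogonal_independent)
  thus "finite B" "card B \<le> DIM('a)" using independent_bound by auto
qed

lemma orthonormal_inner_sum:
  assumes "orthonormal B" "b \<in> B"
  shows "(\<Sum>b'\<in>B. c b' *\<^sub>R b') \<bullet> b = c b"
proof -
  have fin: "finite B" using assms(1) by (rule orthonormal_finite_card)
  have "(\<Sum>b'\<in>B. c b' *\<^sub>R b') \<bullet> b = (\<Sum>b'\<in>B. c b' * (b' \<bullet> b))"
    by (simp add: inner_sum_left)
  also have "\<dots> = (\<Sum>b'\<in>B. if b' = b then c b else 0)"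
    using assms by (intro sum.cong)
      (auto simp: orthonormal_def pairwise_def orthogonal_def norm_eq_1)
  also have "\<dots> = c b" using assms fin by simp
  finally show ?thesis .
qed

lemma lborel_eq_coordinate_lborel:
  "(lborel :: 'a::euclidean_space measure) = coordinate_lborel 0 Basis"
  by (simp add: coordinate_lborel_def lborel_eq[symmetric])

lemma affine_lborel_coordinates:
  fixes H :: "'a::euclidean_space set"
  assumes "affine H" "x \<in> H"
  obtains p B where "orthonormal B" "x - p \<in> span B" "\<And>c. p + (\<Sum>b\<in>B. c b *\<^sub>R b) \<in> H"
    "affine_lborel H = coordinate_lborel p B"
proof -
  define p where "p = (SOME p. p \<in> H)"
  define V where "V = {y - p | y. y \<in> H}"
  define B where "B = (SOME B. orthonormal_basis_of V B)"
  have p: "p \<in> H" unfolding p_def using assms(2) by (rule someI)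
  have "V = (\<lambda>y. y - p) ` H" by (auto simp: V_def)
  hence "subspace V" using affine_diffs_subspace_subtract[OF assms(1) p] by simp
  then obtain B' where "pairwise orthogonal B'" "\<And>x. x \<in> B' \<Longrightarrow> norm x = 1" "span B' = V"
    by (rule orthonormal_basis_subspace) blast
  hence "orthonormal_basis_of V B'" by (auto simp: orthonormal_basis_of_def)
  hence B: "orthonormal_basis_of V B" unfolding B_def by (rule someI)
  show thesis
  proof
    show "orthonormal B" using B by (simp add: orthonormal_basis_of_def orthonormal_def)
    show "x - p \<in> span B" using B assms(2) by (auto simp: orthonormal_basis_of_def V_def)
    show "affine_lborel H = coordinate_lborel p B"
      unfolding affine_lborel_def coordinate_lborel_def Let_def B_def V_def p_def ..
    fix c
    have "(\<Sum>b\<in>B. c b *\<^sub>R b) \<in> span B" by (intro span_sum span_scale span_base)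
    hence "(\<Sum>b\<in>B. c b *\<^sub>R b) \<in> V" using B by (simp add: orthonormal_basis_of_def)
    then obtain y where "y \<in> H" "(\<Sum>b\<in>B. c b *\<^sub>R b) = y - p" by (auto simp: V_def)
    thus "p + (\<Sum>b\<in>B. c b *\<^sub>R b) \<in> H" by simp
  qed
qed

lemma coordinates_measurable [measurable]:
  "(\<lambda>c. p + (\<Sum>b\<in>B. c b *\<^sub>R b)) \<in> (\<Pi>\<^sub>M b\<in>B. (lborel :: real measure)) \<rightarrow>\<^sub>M borel"
  for p :: "'a::euclidean_space"
  by measurable

lemma sets_coordinate_lborel [measurable_cong, simp]: "sets (coordinate_lborel p B) = sets borel"
  by (simp add: coordinate_lborel_def)

section \<open>Two bounds that are uniform over affine subspaces\<close>

definition exp_abs_integral :: "real \<Rightarrow> ennreal" where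
  "exp_abs_integral \<alpha> = (\<integral>\<^sup>+ t. ennreal (exp (- (\<alpha> * \<bar>t\<bar>))) \<partial>lborel)"

lemma exp_abs_integral_translate:
  "(\<integral>\<^sup>+ t. ennreal (exp (- (\<alpha> * \<bar>q + t\<bar>))) \<partial>lborel) = exp_abs_integral \<alpha>"
  unfolding exp_abs_integral_def
  using nn_integral_real_affine[of "\<lambda>t. ennreal (exp (- (\<alpha> * \<bar>t\<bar>)))" 1 q] by simp

lemma exp_abs_integral_finite:
  assumes "\<alpha> > 0"
  shows "exp_abs_integral \<alpha> < \<infinity>"
proof -
  define h where "h = (\<lambda>t::real. ennreal (exp (-t)) * indicator {0..} t)"
  have [measurable]: "h \<in> borel_measurable borel" by (simp add: h_def)
  have h: "(\<integral>\<^sup>+ t. h t \<partial>lborel) = 1"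
    using nn_intergal_power_times_exp_Ici[of 0] by (simp add: h_def)
  have scaled: "(\<integral>\<^sup>+ t. h (c * t) \<partial>lborel) < \<infinity>" if "c \<noteq> 0" for c
  proof -
    have "1 = ennreal \<bar>c\<bar> * (\<integral>\<^sup>+ t. h (c * t) \<partial>lborel)"
      using nn_integral_real_affine[of h c 0] that h by simp
    thus ?thesis using that by (cases "(\<integral>\<^sup>+ t. h (c * t) \<partial>lborel) = top")
      (simp_all add: ennreal_mult_top less_top)
  qed
  have "exp_abs_integral \<alpha> \<le> (\<integral>\<^sup>+ t. h (\<alpha> * t) + h ((-\<alpha>) * t) \<partial>lborel)"
    unfolding exp_abs_integral_def
  proof (rule nn_integral_mono)
    fix t :: real
    show "ennreal (exp (- (\<alpha> * \<bar>t\<bar>))) \<le> h (\<alpha> * t) + h ((-\<alpha>) * t)"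
      using assms by (cases "t \<ge> 0")
        (auto simp: h_def zero_le_mult_iff mult_le_0_iff indicator_def)
  qed
  also have "\<dots> = (\<integral>\<^sup>+ t. h (\<alpha> * t) \<partial>lborel) + (\<integral>\<^sup>+ t. h ((-\<alpha>) * t) \<partial>lborel)"
    by (rule nn_integral_add) simp_all
  also have "\<dots> < \<infinity>" using scaled[of \<alpha>] scaled[of "-\<alpha>"] assms by (simp add: less_top)
  finally show ?thesis .
qed

text \<open>
  The norm of a point dominates the mean of its coordinates in any orthonormal system, which makes
  the integrand at most a product of functions of one coordinate each. The offset \<open>p\<close> only
  translates these factors, so the bound does not depend on the position of the subspace.
\<close>

lemma nn_integral_exp_norm_bound:
  assumes "\<alpha> > 0"
  obtains K :: real where "K \<ge> 0"
    "\<And>(p::'a::euclidean_space) B. orthonormal B \<Longrightarrow>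
       (\<integral>\<^sup>+ y. ennreal (exp (- (\<alpha> * norm y))) \<partial>coordinate_lborel p B) \<le> ennreal K"
proof -
  define d where "d = DIM('a)"
  define \<beta> where "\<beta> = \<alpha> / d"
  define k where "k = exp_abs_integral \<beta>"
  have d: "d > 0" by (simp add: d_def)
  have \<beta>: "\<beta> > 0" using assms d by (simp add: \<beta>_def)
  hence k: "k < \<infinity>" unfolding k_def by (rule exp_abs_integral_finite)
  \<comment> \<open>The maximum with one makes the exponent \<open>d\<close> the worst case among all \<open>card B \<le> d\<close>.\<close>
  define K where "K = max 1 k ^ d"
  have "K < \<infinity>" using k by (simp add: K_def power_less_top_ennreal max_def)
  then obtain K' where K': "K' \<ge> 0" "K = ennreal K'" by (metis ennreal_cases less_irrefl infinity_ennreal_def)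
  show thesis
  proof
    show "K' \<ge> 0" by fact
    fix p :: 'a and B :: "'a set"
    assume B: "orthonormal B"
    note fin = orthonormal_finite_card(1)[OF B] and card = orthonormal_finite_card(2)[OF B]
    interpret product_sigma_finite "\<lambda>_::'a. lborel :: real measure" by standard
    have "(\<integral>\<^sup>+ y. ennreal (exp (- (\<alpha> * norm y))) \<partial>coordinate_lborel p B)
        = (\<integral>\<^sup>+ c. ennreal (exp (- (\<alpha> * norm (p + (\<Sum>b\<in>B. c b *\<^sub>R b))))) \<partial>(\<Pi>\<^sub>M b\<in>B. lborel))"
      unfolding coordinate_lborel_def by (subst nn_integral_distr) (simp_all add: coordinates_measurable)
    also have "\<dots> \<le> (\<integral>\<^sup>+ c. (\<Prod>b\<in>B. ennreal (exp (- (\<beta> * \<bar>p \<bullet> b + c b\<bar>)))) \<partial>(\<Pi>\<^sub>M b\<in>B. lborel))"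
    proof (rule nn_integral_mono)
      fix c :: "'a \<Rightarrow> real"
      define y where "y = p + (\<Sum>b\<in>B. c b *\<^sub>R b)"
      have coord: "\<bar>p \<bullet> b + c b\<bar> \<le> norm y" if "b \<in> B" for b
      proof -
        have "p \<bullet> b + c b = y \<bullet> b"
          using orthonormal_inner_sum[OF B that, of c] by (simp add: y_def inner_add_left)
        moreover have "norm b = 1" using B that by (simp add: orthonormal_def)
        ultimately show ?thesis using Cauchy_Schwarz_ineq2[of y b] by simp
      qed
      have "(\<Sum>b\<in>B. \<beta> * \<bar>p \<bullet> b + c b\<bar>) \<le> (\<Sum>b\<in>B. \<beta> * norm y)"
        using \<beta> coord by (intro sum_mono mult_left_mono) auto
      also have "\<dots> = card B * (\<beta> * norm y)" by simp
      also have "\<dots> \<le> d * (\<beta> * norm y)"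
        using card \<beta> by (intro mult_right_mono) (auto simp: d_def)
      also have "\<dots> = \<alpha> * norm y" using d by (simp add: \<beta>_def)
      finally have "exp (- (\<alpha> * norm y)) \<le> exp (\<Sum>b\<in>B. - (\<beta> * \<bar>p \<bullet> b + c b\<bar>))"
        by (simp add: sum_negf)
      also have "\<dots> = (\<Prod>b\<in>B. exp (- (\<beta> * \<bar>p \<bullet> b + c b\<bar>)))" using fin by (rule exp_sum)
      finally show "ennreal (exp (- (\<alpha> * norm (p + (\<Sum>b\<in>B. c b *\<^sub>R b)))))
          \<le> (\<Prod>b\<in>B. ennreal (exp (- (\<beta> * \<bar>p \<bullet> b + c b\<bar>))))"
        unfolding y_def[symmetric] by (subst prod_ennreal) (auto intro: ennreal_leI)
    qed
    also have "\<dots> = (\<Prod>b\<in>B. k)"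
      using fin by (subst product_nn_integral_prod) (simp_all add: exp_abs_integral_translate k_def)
    also have "\<dots> \<le> max 1 k ^ card B" by (simp add: power_mono)
    also have "\<dots> \<le> K" unfolding K_def using card by (intro power_increasing) (auto simp: d_def)
    finally show "(\<integral>\<^sup>+ y. ennreal (exp (- (\<alpha> * norm y))) \<partial>coordinate_lborel p B) \<le> ennreal K'"
      by (simp add: K')
  qed
qed

text \<open>
  A cube in orthonormal coordinates around the centre lies in the ball; its side is chosen for the
  dimension of the ambient space, hence serves subspaces of all dimensions.
\<close>

lemma affine_subspace_cball_measure_bound:
  assumes "\<rho> > 0"
  obtains c :: real where "c > 0"
    "\<And>(p::'a::euclidean_space) B x. orthonormal B \<Longrightarrow> x - p \<in> span B \<Longrightarrow>
       ennreal c \<le> emeasure (coordinate_lborel p B) (cball x \<rho>)"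
proof -
  define d where "d = DIM('a)"
  define r where "r = \<rho> / d"
  have d: "d > 0" by (simp add: d_def)
  have r: "r > 0" using assms d by (simp add: r_def)
  show thesis
  proof
    \<comment> \<open>Capping the side length \<open>2 * r\<close> at one makes the exponent \<open>d\<close> the worst case among all \<open>card B \<le> d\<close>.\<close>
    show "min 1 (2 * r) ^ d > 0" using r by simp
    fix p x :: 'a and B :: "'a set"
    assume B: "orthonormal B" and x: "x - p \<in> span B"
    note fin = orthonormal_finite_card(1)[OF B] and card = orthonormal_finite_card(2)[OF B]
    interpret product_sigma_finite "\<lambda>_::'a. lborel :: real measure" by standard
    obtain u where u: "x - p = (\<Sum>b\<in>B. u b *\<^sub>R b)"
      using x fin by (auto simp: span_finite)
    have "ennreal (min 1 (2 * r) ^ d) \<le> ennreal (min 1 (2 * r) ^ card B)"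
      using card r by (intro ennreal_leI power_decreasing) (auto simp: d_def)
    also have "\<dots> \<le> ennreal ((2 * r) ^ card B)"
      using r by (intro ennreal_leI power_mono) auto
    also have "\<dots> = (\<Prod>b\<in>B. emeasure lborel {u b - r .. u b + r})"
      using r by (simp add: ennreal_power)
    also have "\<dots> = emeasure (\<Pi>\<^sub>M b\<in>B. lborel) (\<Pi>\<^sub>E b\<in>B. {u b - r .. u b + r})"
      using fin by (subst emeasure_PiM) simp_all
    also have "\<dots> \<le> emeasure (\<Pi>\<^sub>M b\<in>B. lborel)
        ((\<lambda>c. p + (\<Sum>b\<in>B. c b *\<^sub>R b)) -` cball x \<rho> \<inter> space (\<Pi>\<^sub>M b\<in>B. lborel))"
    proof (rule emeasure_mono)
      show "(\<Pi>\<^sub>E b\<in>B. {u b - r .. u b + r})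
          \<subseteq> (\<lambda>c. p + (\<Sum>b\<in>B. c b *\<^sub>R b)) -` cball x \<rho> \<inter> space (\<Pi>\<^sub>M b\<in>B. lborel)"
      proof
        fix c assume c: "c \<in> (\<Pi>\<^sub>E b\<in>B. {u b - r .. u b + r})"
        have "x - (p + (\<Sum>b\<in>B. c b *\<^sub>R b)) = (\<Sum>b\<in>B. (u b - c b) *\<^sub>R b)"
          using u by (simp add: scaleR_diff_left sum_subtractf algebra_simps)
        hence "dist x (p + (\<Sum>b\<in>B. c b *\<^sub>R b)) \<le> (\<Sum>b\<in>B. norm ((u b - c b) *\<^sub>R b))"
          by (simp only: dist_norm) (rule norm_sum)
        also have "\<dots> \<le> (\<Sum>b\<in>B. r)"
        proof (rule sum_mono)
          fix b assume b: "b \<in> B"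
          have "c b \<in> {u b - r .. u b + r}" using c b by (rule PiE_mem)
          thus "norm ((u b - c b) *\<^sub>R b) \<le> r" using B b by (auto simp: orthonormal_def)
        qed
        also have "\<dots> \<le> d * r" using card r by (simp add: d_def)
        also have "\<dots> = \<rho>" using d by (simp add: r_def)
        finally show "c \<in> (\<lambda>c. p + (\<Sum>b\<in>B. c b *\<^sub>R b)) -` cball x \<rho> \<inter> space (\<Pi>\<^sub>M b\<in>B. lborel)"
          using c by (simp add: space_PiM PiE_iff)
      qed
      show "(\<lambda>c. p + (\<Sum>b\<in>B. c b *\<^sub>R b)) -` cball x \<rho> \<inter> space (\<Pi>\<^sub>M b\<in>B. (lborel :: real measure))
          \<in> sets (\<Pi>\<^sub>M b\<in>B. lborel)"
        by (rule measurable_sets[OF coordinates_measurable]) simp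
    qed
    also have "\<dots> = emeasure (coordinate_lborel p B) (cball x \<rho>)"
      unfolding coordinate_lborel_def by (rule emeasure_distr[symmetric, OF coordinates_measurable]) simp
    finally show "ennreal (min 1 (2 * r) ^ d) \<le> emeasure (coordinate_lborel p B) (cball x \<rho>)" .
  qed
qed

section \<open>Integrable convex potentials\<close>

locale integrable_potential =
  fixes g :: "'a::euclidean_space \<Rightarrow> real"
  assumes convex: "convex_on UNIV g"
    and continuous: "continuous_on UNIV g"
    and integral_finite: "(\<integral>\<^sup>+ x. ennreal (exp (- g x)) \<partial>lborel) < \<infinity>"
begin

lemma measurable_potential [measurable]: "g \<in> borel_measurable borel"
  using continuous by (rule borel_measurable_continuous_onI)

lemma convex_combination:
  assumes "0 \<le> u" "u \<le> 1"
  shows "g ((1 - u) *\<^sub>R x + u *\<^sub>R y) \<le> (1 - u) * g x + u * g y"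
  using convex_onD[OF convex, of u x y] assms by simp

lemma bounded_near_0:
  obtains r where "r > 0" "\<And>z. norm z \<le> r \<Longrightarrow> g z \<le> g 0 + 1"
proof -
  have "isCont g 0" using continuous by (simp add: continuous_on_eq_continuous_at)
  then obtain d where d: "d > 0" "\<And>z. dist z 0 < d \<Longrightarrow> dist (g z) (g 0) < 1"
    unfolding continuous_at_eps_delta by (metis zero_less_one)
  show thesis
  proof
    show "d / 2 > 0" using d by simp
    fix z :: 'a assume "norm z \<le> d / 2"
    hence "dist (g z) (g 0) < 1" using d by (intro d(2)) simp
    thus "g z \<le> g 0 + 1" by (simp add: dist_real_def)
  qed
qed

text \<open>On the sublevel set the density is at least \<open>exp (- s)\<close>; this is Markov's inequality.\<close>

lemma sublevel_measure_finite: "emeasure lborel {x. g x \<le> s} < \<infinity>"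
proof -
  have "{x. g x \<le> s} = {x \<in> space lborel. 1 \<le> ennreal (exp s) * ennreal (exp (- g x))}"
    by (auto simp: ennreal_mult[symmetric] exp_add[symmetric] simp flip: ennreal_1)
  also have "emeasure lborel \<dots> \<le> ennreal (exp s) * (\<integral>\<^sup>+ x. ennreal (exp (- g x)) \<partial>lborel)"
    using nn_integral_Markov_inequality[of "\<lambda>x. ennreal (exp (- g x))" UNIV lborel "ennreal (exp s)"]
    by simp
  also have "\<dots> < \<infinity>" using integral_finite by (simp add: ennreal_mult_less_top)
  finally show ?thesis .
qed

text \<open>
  A point \<open>v\<close> far away in the sublevel set spans, with a ball around the origin, a cone in the
  sublevel set. The half of this cone near the origin contains a row of about \<open>norm v / (2 * r)\<close>
  disjoint balls of radius \<open>r / 4\<close>, so an unbounded sublevel set would have infinite volume.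
\<close>

lemma sublevel_bounded: "bounded {x. g x \<le> g 0 + 1}"
proof -
  obtain r where r: "r > 0" "\<And>z. norm z \<le> r \<Longrightarrow> g z \<le> g 0 + 1"
    by (rule bounded_near_0) blast
  define S where "S = {x. g x \<le> g 0 + 1}"
  have S_measurable: "S \<in> sets lborel" unfolding S_def by measurable
  obtain w where w: "w > 0" "\<And>x. ennreal w \<le> emeasure lborel (cball (x::'a) (r / 4))"
  proof -
    obtain w where "w > 0" "\<And>(p::'a) B x. orthonormal B \<Longrightarrow> x - p \<in> span B \<Longrightarrow>
       ennreal w \<le> emeasure (coordinate_lborel p B) (cball x (r / 4))"
      using affine_subspace_cball_measure_bound[of "r / 4"] r(1) by (metis divide_pos_pos zero_less_numeral)
    thus thesis
      by (intro that[of w]) (auto simp: lborel_eq_coordinate_lborel orthonormal_Basis)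
  qed
  obtain V where V: "emeasure lborel S = ennreal V" "V \<ge> 0"
    using sublevel_measure_finite[of "g 0 + 1"] unfolding S_def
    by (metis ennreal_cases less_irrefl infinity_ennreal_def)
  obtain N :: nat where N: "N * w > V" using w(1) by (metis reals_Archimedean3)
  have "norm v \<le> 2 * N * r" if v: "v \<in> S" for v
  proof (rule ccontr)
    assume "\<not> norm v \<le> 2 * N * r"
    hence far: "norm v > 2 * N * r" by simp
    hence v0: "norm v > 0" using r(1) by (smt (verit) mult_nonneg_nonneg of_nat_0_le_iff)
    define s where "s = (\<lambda>k::nat. k * r / norm v)"
    define E where "E = (\<lambda>k. cball (s k *\<^sub>R v) (r / 4))"
    have E_S: "E k \<subseteq> S" if k: "k < N" for k
    proof
      fix y assume "y \<in> E k"
      hence y: "norm (y - s k *\<^sub>R v) \<le> r / 4" by (simp add: E_def dist_norm norm_minus_commute)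
      have "k * r \<le> N * r" using k r(1) by (intro mult_right_mono) auto
      hence "k * r \<le> (1 / 2) * norm v" using far by simp
      hence s: "0 \<le> s k" "s k \<le> 1 / 2" using v0 r(1) by (simp_all add: s_def pos_divide_le_eq)
      define z where "z = (1 / (1 - s k)) *\<^sub>R (y - s k *\<^sub>R v)"
      have "norm z = (1 / (1 - s k)) * norm (y - s k *\<^sub>R v)" using s by (simp add: z_def)
      also have "\<dots> \<le> 2 * (r / 4)" using s y r(1) by (intro mult_mono) (auto simp: field_simps)
      finally have "g z \<le> g 0 + 1" using r by simp
      moreover have "y = (1 - s k) *\<^sub>R z + s k *\<^sub>R v" using s by (simp add: z_def)
      ultimately have "g y \<le> (1 - s k) * g z + s k * g v"
        using convex_combination[of "s k" z v] s by simp
      also have "\<dots> \<le> (1 - s k) * (g 0 + 1) + s k * (g 0 + 1)"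
        using s v \<open>g z \<le> g 0 + 1\<close> by (intro add_mono mult_left_mono) (auto simp: S_def)
      finally show "y \<in> S" by (simp add: S_def algebra_simps)
    qed
    have disj: "disjoint_family_on E {..<N}"
    proof (unfold disjoint_family_on_def, intro ballI impI)
      fix j k :: nat assume jk: "j \<noteq> k"
      have "dist (s j *\<^sub>R v) (s k *\<^sub>R v) = \<bar>s j - s k\<bar> * norm v"
        by (simp add: dist_norm flip: scaleR_diff_left)
      also have "\<dots> = \<bar>real j - real k\<bar> * r"
        using v0 r(1) by (simp add: s_def abs_mult flip: diff_divide_distrib left_diff_distrib)
      also have "\<dots> \<ge> 1 * r" using jk r(1) by (intro mult_right_mono) auto
      finally have sep: "r \<le> dist (s j *\<^sub>R v) (s k *\<^sub>R v)" by simp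
      show "E j \<inter> E k = {}"
      proof (rule ccontr)
        assume "E j \<inter> E k \<noteq> {}"
        then obtain y where "dist (s j *\<^sub>R v) y \<le> r / 4" "dist (s k *\<^sub>R v) y \<le> r / 4"
          by (auto simp: E_def)
        hence "dist (s j *\<^sub>R v) (s k *\<^sub>R v) \<le> r / 4 + r / 4"
          by (intro order_trans[OF dist_triangle2 add_mono])
        thus False using sep r(1) by simp
      qed
    qed
    have "ennreal (N * w) = (\<Sum>k<N. ennreal w)" using w(1) by (simp add: ennreal_mult ennreal_of_nat_eq_real_of_nat)
    also have "\<dots> \<le> (\<Sum>k<N. emeasure lborel (E k))" unfolding E_def by (intro sum_mono w)
    also have "\<dots> = emeasure lborel (\<Union>k<N. E k)"
      by (rule sum_emeasure[OF _ disj]) (auto simp: E_def)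
    also have "\<dots> \<le> emeasure lborel S" using E_S by (intro emeasure_mono S_measurable) auto
    finally show False using V N by (simp add: ennreal_le_iff)
  qed
  thus ?thesis unfolding S_def bounded_iff by blast
qed

lemma linear_growth:
  obtains a b where "a > 0" "\<And>x. g x \<ge> a * norm x - b"
proof -
  obtain R where R: "R > 0" "\<And>x. g x \<le> g 0 + 1 \<Longrightarrow> norm x < R"
    using sublevel_bounded unfolding bounded_pos_less by auto
  have "bounded (g ` cball 0 R)"
    using continuous by (intro compact_imp_bounded compact_continuous_image) (auto intro: continuous_on_subset)
  then obtain c where c: "\<And>x. norm x \<le> R \<Longrightarrow> \<bar>g x\<bar> \<le> c"
    unfolding bounded_iff by (force simp: Ball_def)
  show thesis
  proof
    show "1 / R > 0" using R by simp
    fix x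
    show "g x \<ge> (1 / R) * norm x - (1 + c)"
    proof (cases "norm x \<le> R")
      case True
      hence "(1 / R) * norm x \<le> 1" using R by simp
      thus ?thesis using c[OF True] by linarith
    next
      case False
      \<comment> \<open>Between \<open>0\<close> and the sphere of radius \<open>R\<close> the slope is at least \<open>1 / R\<close>, and it cannot decrease further out.\<close>
      define u where "u = R / norm x"
      have "norm x > 0" using False R(1) by linarith
      hence u: "0 < u" "u \<le> 1" using False R(1) by (simp_all add: u_def)
      have "norm (u *\<^sub>R x) = R" using \<open>norm x > 0\<close> R(1) by (simp add: u_def)
      hence "g (u *\<^sub>R x) > g 0 + 1" using R(2)[of "u *\<^sub>R x"] by force
      also have "g (u *\<^sub>R x) \<le> (1 - u) * g 0 + u * g x" using convex_combination[of u 0 x] u by simp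
      finally have "u * g x > u * (g 0 + 1 / u)" using u by (simp add: algebra_simps)
      hence "g x > g 0 + 1 / u" using u by simp
      thus ?thesis using c[of 0] R by (simp add: u_def)
    qed
  qed
qed

section \<open>Integrals near and away from a sublevel set\<close>

text \<open>
  If \<open>lam *\<^sub>R x\<close> lies in the sublevel set of height \<open>t\<close>, then points near \<open>x\<close> are convex
  combinations of \<open>lam *\<^sub>R x\<close>, with weight \<open>1 / lam\<close>, and points near the origin, so the potential
  is at most \<open>t / lam\<close> there, up to a constant.
\<close>

lemma integral_near_point:
  assumes lam: "lam > 1"
  obtains \<rho> c where "\<rho> > 0" "c > 0"
    "\<And>t x z p B. g (lam *\<^sub>R x) \<le> t \<Longrightarrow> dist x z \<le> \<rho> \<Longrightarrow> orthonormal B \<Longrightarrow> z - p \<in> span B \<Longrightarrow>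
       ennreal (c * exp (- (t / lam)))
         \<le> (\<integral>\<^sup>+ y. ennreal (exp (- g y)) * indicator (cball z \<rho>) y \<partial>coordinate_lborel p B)"
proof -
  obtain r where r: "r > 0" "\<And>z. norm z \<le> r \<Longrightarrow> g z \<le> g 0 + 1"
    by (rule bounded_near_0) blast
  define u where "u = 1 / lam"
  have u: "0 < u" "u < 1" using lam by (auto simp: u_def)
  define \<rho> where "\<rho> = (1 - u) * r / 2"
  have \<rho>: "\<rho> > 0" using u r by (simp add: \<rho>_def)
  obtain k where k: "k > 0" "\<And>(p::'a) B x. orthonormal B \<Longrightarrow> x - p \<in> span B \<Longrightarrow>
       ennreal k \<le> emeasure (coordinate_lborel p B) (cball x \<rho>)"
    using affine_subspace_cball_measure_bound[OF \<rho>] by metis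
  define C where "C = (1 - u) * (g 0 + 1)"
  have near: "g y \<le> t / lam + C" if "g (lam *\<^sub>R x) \<le> t" "dist x y \<le> 2 * \<rho>" for t x y
  proof -
    define z where "z = (1 / (1 - u)) *\<^sub>R (y - x)"
    have "norm z = (1 / (1 - u)) * norm (y - x)" using u by (simp add: z_def)
    also have "\<dots> \<le> (1 / (1 - u)) * (2 * \<rho>)"
      using that(2) u by (intro mult_left_mono) (auto simp: dist_norm norm_minus_commute)
    also have "\<dots> = r" using u by (simp add: \<rho>_def)
    finally have "(1 - u) * g z \<le> C" using r(2) u by (simp add: C_def)
    moreover have "u * g (lam *\<^sub>R x) \<le> t / lam" using that(1) lam by (simp add: u_def divide_right_mono)
    moreover have "y = (1 - u) *\<^sub>R z + u *\<^sub>R (lam *\<^sub>R x)" using u lam by (simp add: z_def u_def)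
    ultimately show ?thesis using convex_combination[of u z "lam *\<^sub>R x"] u by simp
  qed
  show thesis
  proof
    show "\<rho> > 0" by fact
    show "k * exp (- C) > 0" using k by simp
    fix t and x z p :: 'a and B :: "'a set"
    assume a: "g (lam *\<^sub>R x) \<le> t" "dist x z \<le> \<rho>" "orthonormal B" "z - p \<in> span B"
    have "ennreal (k * exp (- C) * exp (- (t / lam))) = ennreal (exp (- (t / lam + C))) * ennreal k"
      using k(1) by (simp add: ennreal_mult[symmetric] exp_add exp_diff exp_minus field_simps)
    also have "\<dots> \<le> ennreal (exp (- (t / lam + C))) * emeasure (coordinate_lborel p B) (cball z \<rho>)"
      using k(2)[OF a(3,4)] by (rule mult_left_mono) simp
    also have "\<dots> = (\<integral>\<^sup>+ y. ennreal (exp (- (t / lam + C))) * indicator (cball z \<rho>) y \<partial>coordinate_lborel p B)"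
      by (subst nn_integral_cmult_indicator) simp_all
    also have "\<dots> \<le> (\<integral>\<^sup>+ y. ennreal (exp (- g y)) * indicator (cball z \<rho>) y \<partial>coordinate_lborel p B)"
    proof (rule nn_integral_mono)
      fix y
      have "g y \<le> t / lam + C" if "y \<in> cball z \<rho>"
        using that a(2) by (intro near[OF a(1)]) (use dist_triangle[of x y z] in auto)
      thus "ennreal (exp (- (t / lam + C))) * indicator (cball z \<rho>) y
          \<le> ennreal (exp (- g y)) * indicator (cball z \<rho>) y"
        by (auto simp: indicator_def intro!: ennreal_leI)
    qed
    finally show "ennreal (k * exp (- C) * exp (- (t / lam)))
        \<le> (\<integral>\<^sup>+ y. ennreal (exp (- g y)) * indicator (cball z \<rho>) y \<partial>coordinate_lborel p B)" .
  qed
qed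

text \<open>
  Outside the dilate by \<open>lam\<close> of the sublevel set of height \<open>t\<close>, convexity along rays gives
  \<open>g y \<ge> lam * t - (lam - 1) * g 0\<close>. A small multiple \<open>\<eta> * g y\<close> of the potential is kept to make
  the integral converge. Up to a constant, the rest \<open>(1 - \<eta>) * g y\<close> is still at least \<open>t\<close> times a
  factor greater than one, since \<open>(1 - \<eta>) * lam = (lam + 1) / 2\<close> for the choice of \<open>\<eta>\<close> below.
\<close>

lemma integral_outside_dilated_sublevel:
  assumes lam: "lam > 1"
  obtains \<kappa> C where "\<kappa> > 1" "C \<ge> 0"
    "\<And>t p B E. orthonormal B \<Longrightarrow> (\<And>y. y \<in> E \<Longrightarrow> g ((1 / lam) *\<^sub>R y) > t) \<Longrightarrow>
       (\<integral>\<^sup>+ y. ennreal (exp (- g y)) * indicator E y \<partial>coordinate_lborel p B)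
         \<le> ennreal (C * exp (- (\<kappa> * t)))"
proof -
  obtain a b where ab: "a > 0" "\<And>x. g x \<ge> a * norm x - b" by (rule linear_growth) blast
  define \<eta> where "\<eta> = (1 - 1 / lam) / 2"
  have \<eta>: "0 < \<eta>" "\<eta> < 1" using lam by (auto simp: \<eta>_def field_simps)
  obtain K where K: "K \<ge> 0" "\<And>(p::'a) B. orthonormal B \<Longrightarrow>
       (\<integral>\<^sup>+ y. ennreal (exp (- (\<eta> * a * norm y))) \<partial>coordinate_lborel p B) \<le> ennreal K"
    using nn_integral_exp_norm_bound[of "\<eta> * a"] \<eta> ab(1) by (metis mult_pos_pos)
  define \<kappa> where "\<kappa> = (1 - \<eta>) * lam"
  define C where "C = exp ((1 - \<eta>) * (lam - 1) * g 0 + \<eta> * b)"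
  have pointwise: "exp (- g y) \<le> C * exp (- (\<kappa> * t)) * exp (- (\<eta> * a * norm y))"
    if "g ((1 / lam) *\<^sub>R y) > t" for t y
  proof -
    have "t < (1 - 1 / lam) * g 0 + (1 / lam) * g y"
      using convex_combination[of "1 / lam" 0 y] lam that by simp
    hence "lam * t < lam * ((1 - 1 / lam) * g 0 + (1 / lam) * g y)" using lam by simp
    also have "\<dots> = (lam - 1) * g 0 + g y" using lam by (simp add: field_simps)
    finally have "(1 - \<eta>) * g y \<ge> (1 - \<eta>) * (lam * t - (lam - 1) * g 0)"
      using \<eta> by (intro mult_left_mono) auto
    moreover have "\<eta> * g y \<ge> \<eta> * (a * norm y - b)" using ab(2) \<eta> by (intro mult_left_mono) auto
    ultimately have "- g y \<le> ((1 - \<eta>) * (lam - 1) * g 0 + \<eta> * b) + - (\<kappa> * t) + - (\<eta> * a * norm y)"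
      by (simp add: \<kappa>_def algebra_simps)
    thus ?thesis unfolding C_def exp_add[symmetric] by simp
  qed
  show thesis
  proof
    show "\<kappa> > 1" using lam by (simp add: \<kappa>_def \<eta>_def field_simps)
    show "C * K \<ge> 0" using K by (simp add: C_def)
    fix t and p :: 'a and B E :: "'a set"
    assume B: "orthonormal B" and E: "\<And>y. y \<in> E \<Longrightarrow> g ((1 / lam) *\<^sub>R y) > t"
    have "(\<integral>\<^sup>+ y. ennreal (exp (- g y)) * indicator E y \<partial>coordinate_lborel p B)
        \<le> (\<integral>\<^sup>+ y. ennreal (C * exp (- (\<kappa> * t))) * ennreal (exp (- (\<eta> * a * norm y))) \<partial>coordinate_lborel p B)"
    proof (rule nn_integral_mono)
      fix y
      show "ennreal (exp (- g y)) * indicator E y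
          \<le> ennreal (C * exp (- (\<kappa> * t))) * ennreal (exp (- (\<eta> * a * norm y)))"
        using pointwise[OF E, of y]
        by (auto simp: indicator_def C_def ennreal_mult[symmetric] intro: ennreal_leI)
    qed
    also have "\<dots> = ennreal (C * exp (- (\<kappa> * t))) * (\<integral>\<^sup>+ y. ennreal (exp (- (\<eta> * a * norm y))) \<partial>coordinate_lborel p B)"
      by (rule nn_integral_cmult) measurable
    also have "\<dots> \<le> ennreal (C * exp (- (\<kappa> * t))) * ennreal K"
      by (intro mult_left_mono K B) simp
    also have "\<dots> = ennreal (C * K * exp (- (\<kappa> * t)))"
      using K(1) by (simp add: C_def ennreal_mult[symmetric] mult_ac)
    finally show "(\<integral>\<^sup>+ y. ennreal (exp (- g y)) * indicator E y \<partial>coordinate_lborel p B)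
        \<le> ennreal (C * K * exp (- (\<kappa> * t)))" .
  qed
qed

lemma separating_halfspace:
  assumes "lam > 0" "g 0 \<le> t" "g ((1 / lam) *\<^sub>R x) > t"
  obtains a b where "a \<noteq> 0" "a \<bullet> x < b" "\<And>y. a \<bullet> y < b \<Longrightarrow> g ((1 / lam) *\<^sub>R y) > t"
proof -
  define S where "S = {y. g ((1 / lam) *\<^sub>R y) \<le> t}"
  have "convex S"
  proof (rule convexI)
    fix x y and u v :: real
    assume S: "x \<in> S" "y \<in> S" and uv: "0 \<le> u" "0 \<le> v" "u + v = 1"
    have u: "u = 1 - v" using uv by simp
    have "(1 / lam) *\<^sub>R (u *\<^sub>R x + v *\<^sub>R y)
        = (1 - v) *\<^sub>R ((1 / lam) *\<^sub>R x) + v *\<^sub>R ((1 / lam) *\<^sub>R y)"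
      by (simp only: u scaleR_add_right scaleR_scaleR mult.commute)
    hence "g ((1 / lam) *\<^sub>R (u *\<^sub>R x + v *\<^sub>R y))
        \<le> u * g ((1 / lam) *\<^sub>R x) + v * g ((1 / lam) *\<^sub>R y)"
      unfolding u using convex_combination[of v "(1 / lam) *\<^sub>R x" "(1 / lam) *\<^sub>R y"] uv
      by (simp only:)
    also have "\<dots> \<le> u * t + v * t" using S uv by (intro add_mono mult_left_mono) (auto simp: S_def)
    also have "\<dots> = t" using uv by (simp flip: distrib_right)
    finally show "u *\<^sub>R x + v *\<^sub>R y \<in> S" by (simp add: S_def)
  qed
  moreover have "closed S" unfolding S_def
    by (intro closed_Collect_le continuous_intros continuous_on_compose2[OF continuous]) auto
  moreover have "x \<notin> S" using assms by (simp add: S_def)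
  ultimately obtain a b where ab: "a \<bullet> x < b" "\<And>y. y \<in> S \<Longrightarrow> a \<bullet> y > b"
    by (metis separating_hyperplane_closed_point)
  show thesis
  proof
    have "0 \<in> S" using assms by (simp add: S_def)
    thus "a \<noteq> 0" using ab(1) ab(2)[of 0] by auto
    show "a \<bullet> x < b" by fact
    fix y assume "a \<bullet> y < b"
    hence "y \<notin> S" using ab(2)[of y] by auto
    thus "g ((1 / lam) *\<^sub>R y) > t" by (simp add: S_def)
  qed
qed

section \<open>Comparison of depths with the potential\<close>

text \<open>
  These are the only facts about a depth that the rest of the argument needs. The first exponent,
  \<open>1 / lam\<close>, is less than one and the second, \<open>\<kappa>\<close>, is greater than one, so that both
  constants are absorbed when \<open>dep x\<close> is compared with \<open>exp (- t)\<close> for large \<open>t\<close>.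
\<close>

definition level_comparable :: "('a \<Rightarrow> ennreal) \<Rightarrow> bool" where
  "level_comparable dep \<longleftrightarrow> (\<forall>lam>1.
     (\<exists>c>0. \<forall>t x. g (lam *\<^sub>R x) \<le> t \<longrightarrow> ennreal (c * exp (- (t / lam))) \<le> dep x) \<and>
     (\<exists>\<kappa>>1. \<exists>C\<ge>0. \<forall>t x. g 0 \<le> t \<longrightarrow> g ((1 / lam) *\<^sub>R x) > t \<longrightarrow>
        dep x \<le> ennreal (C * exp (- (\<kappa> * t)))))"

lemma level_comparableI:
  assumes "\<And>lam. lam > 1 \<Longrightarrow>
      \<exists>c>0. \<forall>t x. g (lam *\<^sub>R x) \<le> t \<longrightarrow> ennreal (c * exp (- (t / lam))) \<le> dep x"
    and "\<And>lam. lam > 1 \<Longrightarrow>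
      \<exists>\<kappa>>1. \<exists>C\<ge>0. \<forall>t x. g 0 \<le> t \<longrightarrow> g ((1 / lam) *\<^sub>R x) > t \<longrightarrow>
        dep x \<le> ennreal (C * exp (- (\<kappa> * t)))"
  shows "level_comparable dep"
  using assms unfolding level_comparable_def by blast

lemma halfspace_depth_level_comparable:
  "level_comparable
     (\<lambda>x. ennreal (halfspace_depth (density lborel (\<lambda>x. ennreal (exp (- g x)))) x))"
proof -
  define M where "M = density lborel (\<lambda>x. ennreal (exp (- g x)))"
  have "emeasure M UNIV < \<infinity>" using integral_finite by (simp add: M_def emeasure_density)
  then interpret finite_measure M by (intro finite_measureI) (simp add: M_def less_top)
  have halfspace_measurable: "A \<in> sets borel" if "A \<in> open_halfspaces" for A :: "'a set"
    using that by (auto simp: open_halfspaces_def intro!: borel_open open_halfspace_lt)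
  have halfspace_emeasure: "ennreal (measure M A)
      = (\<integral>\<^sup>+ y. ennreal (exp (- g y)) * indicator A y \<partial>coordinate_lborel 0 Basis)"
    if "A \<in> open_halfspaces" for A
    using halfspace_measurable[OF that] emeasure_eq_measure[of A]
    by (simp add: M_def emeasure_density flip: lborel_eq_coordinate_lborel)
  have "level_comparable (\<lambda>x. ennreal (halfspace_depth M x))"
  proof (rule level_comparableI)
    fix lam :: real assume lam: "lam > 1"
    obtain \<rho> c where \<rho>: "\<rho> > 0" and c: "c > 0"
      "\<And>t x z p B. g (lam *\<^sub>R x) \<le> t \<Longrightarrow> dist x z \<le> \<rho> \<Longrightarrow> orthonormal B \<Longrightarrow> z - p \<in> span B \<Longrightarrow>
       ennreal (c * exp (- (t / lam)))
         \<le> (\<integral>\<^sup>+ y. ennreal (exp (- g y)) * indicator (cball z \<rho>) y \<partial>coordinate_lborel p B)"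
      by (rule integral_near_point[OF lam]) blast
    have "ennreal (c * exp (- (t / lam))) \<le> ennreal (halfspace_depth M x)"
      if x: "g (lam *\<^sub>R x) \<le> t" for t x
    proof (rule ennreal_leI, unfold halfspace_depth_def, rule cINF_greatest)
      obtain e :: 'a where "e \<in> Basis" using nonempty_Basis by blast
      hence "{y. e \<bullet> y < e \<bullet> x + 1} \<in> open_halfspaces" by (auto simp: open_halfspaces_def)
      moreover have "x \<in> {y. e \<bullet> y < e \<bullet> x + 1}" by simp
      ultimately show "{H \<in> open_halfspaces. x \<in> H} \<noteq> {}" by blast
      fix A assume "A \<in> {H \<in> open_halfspaces. x \<in> H}"
      then obtain a b where A: "A \<in> open_halfspaces" "A = {y. a \<bullet> y < b}" "a \<noteq> 0" "a \<bullet> x < b"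
        by (auto simp: open_halfspaces_def)
      \<comment> \<open>The ball of radius \<open>\<rho>\<close> that touches the boundary of the parallel half-space through \<open>x\<close> from inside.\<close>
      define z where "z = x - (\<rho> / norm a) *\<^sub>R a"
      have "cball z \<rho> \<subseteq> A"
      proof
        fix y assume "y \<in> cball z \<rho>"
        hence y: "norm (y - z) \<le> \<rho>" by (simp add: dist_norm norm_minus_commute)
        have "a \<bullet> y = a \<bullet> z + a \<bullet> (y - z)" by (simp add: inner_diff_right)
        also have "a \<bullet> z = a \<bullet> x - norm a * \<rho>"
          using A(3) by (simp add: z_def inner_diff_right power2_norm_eq_inner[symmetric] power2_eq_square)
        also have "a \<bullet> (y - z) \<le> norm a * norm (y - z)" by (rule norm_cauchy_schwarz)
        also have "\<dots> \<le> norm a * \<rho>" using y by (rule mult_left_mono) simp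
        finally show "y \<in> A" using A by simp
      qed
      moreover have "dist x z \<le> \<rho>" using A(3) \<rho> by (simp add: z_def dist_norm)
      ultimately have "ennreal (c * exp (- (t / lam))) \<le> ennreal (measure M A)"
        unfolding halfspace_emeasure[OF A(1)]
        by (intro order_trans[OF c(2)[OF x _ orthonormal_Basis] nn_integral_mono])
           (auto simp: indicator_def)
      thus "c * exp (- (t / lam)) \<le> measure M A" by (simp add: ennreal_le_iff)
    qed
    thus "\<exists>c>0. \<forall>t x. g (lam *\<^sub>R x) \<le> t \<longrightarrow>
        ennreal (c * exp (- (t / lam))) \<le> ennreal (halfspace_depth M x)"
      using c(1) by blast
  next
    fix lam :: real assume lam: "lam > 1"
    obtain \<kappa> C where \<kappa>: "\<kappa> > 1" and C: "C \<ge> 0"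
      "\<And>t p B E. orthonormal B \<Longrightarrow> (\<And>y. y \<in> E \<Longrightarrow> g ((1 / lam) *\<^sub>R y) > t) \<Longrightarrow>
       (\<integral>\<^sup>+ y. ennreal (exp (- g y)) * indicator E y \<partial>coordinate_lborel p B)
         \<le> ennreal (C * exp (- (\<kappa> * t)))"
      by (rule integral_outside_dilated_sublevel[OF lam]) blast
    have "ennreal (halfspace_depth M x) \<le> ennreal (C * exp (- (\<kappa> * t)))"
      if x: "g 0 \<le> t" "g ((1 / lam) *\<^sub>R x) > t" for t x
    proof -
      obtain a b where ab: "a \<noteq> 0" "a \<bullet> x < b" "\<And>y. a \<bullet> y < b \<Longrightarrow> g ((1 / lam) *\<^sub>R y) > t"
        using separating_halfspace[OF _ x] lam by (metis less_trans zero_less_one)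
      define A where "A = {y. a \<bullet> y < b}"
      have A: "A \<in> open_halfspaces" "x \<in> A" using ab by (auto simp: A_def open_halfspaces_def)
      have "halfspace_depth M x \<le> measure M A"
        unfolding halfspace_depth_def using A by (intro cINF_lower bdd_belowI2[of _ 0]) auto
      hence "ennreal (halfspace_depth M x) \<le> ennreal (measure M A)" by (rule ennreal_leI)
      also have "\<dots> \<le> ennreal (C * exp (- (\<kappa> * t)))"
        unfolding halfspace_emeasure[OF A(1)] using ab(3)
        by (intro C(2) orthonormal_Basis) (simp add: A_def)
      finally show ?thesis .
    qed
    thus "\<exists>\<kappa>>1. \<exists>C\<ge>0. \<forall>t x. g 0 \<le> t \<longrightarrow> g ((1 / lam) *\<^sub>R x) > t \<longrightarrow>
        ennreal (halfspace_depth M x) \<le> ennreal (C * exp (- (\<kappa> * t)))"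
      using \<kappa> C(1) by blast
  qed
  thus ?thesis by (simp only: M_def)
qed

text \<open>
  The bound from above uses the hyperplane through \<open>x\<close> that is parallel to the boundary of a
  half-space separating \<open>x\<close> from the dilated sublevel set. In dimension one, hyperplanes are points
  with unit mass, and the argument covers them with the empty basis.
\<close>

lemma hyperplane_depth_level_comparable:
  "level_comparable (hyperplane_depth (\<lambda>x. exp (- g x)))"
proof (rule level_comparableI)
  fix lam :: real assume lam: "lam > 1"
  obtain \<rho> c where \<rho>: "\<rho> > 0" and c: "c > 0"
    "\<And>t x z p B. g (lam *\<^sub>R x) \<le> t \<Longrightarrow> dist x z \<le> \<rho> \<Longrightarrow> orthonormal B \<Longrightarrow> z - p \<in> span B \<Longrightarrow>
     ennreal (c * exp (- (t / lam)))
       \<le> (\<integral>\<^sup>+ y. ennreal (exp (- g y)) * indicator (cball z \<rho>) y \<partial>coordinate_lborel p B)"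
    by (rule integral_near_point[OF lam]) blast
  have "ennreal (c * exp (- (t / lam))) \<le> hyperplane_depth (\<lambda>x. exp (- g x)) x"
    if x: "g (lam *\<^sub>R x) \<le> t" for t x
  proof (unfold hyperplane_depth_def, rule INF_greatest)
    fix H :: "'a set" assume "H \<in> {H \<in> hyperplanes. x \<in> H}"
    hence H: "affine H" "x \<in> H" by (auto simp: hyperplanes_def)
    obtain p B where B: "orthonormal B" "x - p \<in> span B" "affine_lborel H = coordinate_lborel p B"
      using affine_lborel_coordinates[OF H] by metis
    show "ennreal (c * exp (- (t / lam))) \<le> (\<integral>\<^sup>+ y. ennreal (exp (- g y)) \<partial>affine_lborel H)"
      unfolding B(3) using \<rho>
      by (intro order_trans[OF c(2)[OF x _ B(1,2)] nn_integral_mono]) (auto simp: indicator_def)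
  qed
  thus "\<exists>c>0. \<forall>t x. g (lam *\<^sub>R x) \<le> t \<longrightarrow>
      ennreal (c * exp (- (t / lam))) \<le> hyperplane_depth (\<lambda>x. exp (- g x)) x"
    using c(1) by blast
next
  fix lam :: real assume lam: "lam > 1"
  obtain \<kappa> C where \<kappa>: "\<kappa> > 1" and C: "C \<ge> 0"
    "\<And>t p B E. orthonormal B \<Longrightarrow> (\<And>y. y \<in> E \<Longrightarrow> g ((1 / lam) *\<^sub>R y) > t) \<Longrightarrow>
     (\<integral>\<^sup>+ y. ennreal (exp (- g y)) * indicator E y \<partial>coordinate_lborel p B)
       \<le> ennreal (C * exp (- (\<kappa> * t)))"
    by (rule integral_outside_dilated_sublevel[OF lam]) blast
  have "hyperplane_depth (\<lambda>x. exp (- g x)) x \<le> ennreal (C * exp (- (\<kappa> * t)))"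
    if x: "g 0 \<le> t" "g ((1 / lam) *\<^sub>R x) > t" for t x
  proof -
    obtain a b where ab: "a \<noteq> 0" "a \<bullet> x < b" "\<And>y. a \<bullet> y < b \<Longrightarrow> g ((1 / lam) *\<^sub>R y) > t"
      using separating_halfspace[OF _ x] lam by (metis less_trans zero_less_one)
    define H where "H = {y. a \<bullet> y = a \<bullet> x}"
    have H: "affine H" "x \<in> H" by (simp_all add: H_def affine_hyperplane)
    have "H \<in> hyperplanes" using H(1) ab(1) by (simp add: hyperplanes_def H_def)
    hence "hyperplane_depth (\<lambda>x. exp (- g x)) x \<le> (\<integral>\<^sup>+ y. ennreal (exp (- g y)) \<partial>affine_lborel H)"
      unfolding hyperplane_depth_def using H(2) by (intro INF_lower) simp
    also obtain p B where B: "orthonormal B" "\<And>c. p + (\<Sum>b\<in>B. c b *\<^sub>R b) \<in> H"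
        "affine_lborel H = coordinate_lborel p B"
      using affine_lborel_coordinates[OF H] by metis
    have H_measurable: "H \<in> sets borel" unfolding H_def by (intro borel_closed closed_hyperplane)
    have "(\<integral>\<^sup>+ y. ennreal (exp (- g y)) \<partial>affine_lborel H)
        = (\<integral>\<^sup>+ y. ennreal (exp (- g y)) * indicator H y \<partial>coordinate_lborel p B)"
      unfolding B(3) coordinate_lborel_def using H_measurable B(2)
      by (simp add: nn_integral_distr coordinates_measurable)
    also have "\<dots> \<le> ennreal (C * exp (- (\<kappa> * t)))"
      using ab(2,3) by (intro C(2) B(1)) (simp add: H_def)
    finally show ?thesis .
  qed
  thus "\<exists>\<kappa>>1. \<exists>C\<ge>0. \<forall>t x. g 0 \<le> t \<longrightarrow> g ((1 / lam) *\<^sub>R x) > t \<longrightarrow>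
      hyperplane_depth (\<lambda>x. exp (- g x)) x \<le> ennreal (C * exp (- (\<kappa> * t)))"
    using \<kappa> C(1) by blast
qed

section \<open>Level sets between dilates\<close>

definition sandwiched :: "real \<Rightarrow> real \<Rightarrow> 'a set \<Rightarrow> bool" where
  "sandwiched lam t A \<longleftrightarrow>
     (*\<^sub>R) (1 / lam) ` {x. g x \<le> t} \<subseteq> A \<and> A \<subseteq> (*\<^sub>R) lam ` {x. g x \<le> t}"

lemma closed_sublevel: "closed {x. g x \<le> t}"
  by (intro closed_Collect_le continuous continuous_on_const)

lemma sandwiched_closure:
  assumes "sandwiched lam t A"
  shows "sandwiched lam t (closure A)"
proof -
  have "closure A \<subseteq> (*\<^sub>R) lam ` {x. g x \<le> t}"
    using assms by (intro closure_minimal closed_scaling closed_sublevel) (simp add: sandwiched_def)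
  thus ?thesis using assms closure_subset unfolding sandwiched_def by blast
qed

lemma sandwiched_sublevel:
  assumes lam: "lam > 1" and t: "g 0 \<le> t"
  shows "sandwiched lam t {x. g x \<le> t}"
proof -
  have shrink: "g ((1 / lam) *\<^sub>R x) \<le> t" if "g x \<le> t" for x
  proof -
    have "g ((1 / lam) *\<^sub>R x) \<le> (1 - 1 / lam) * g 0 + (1 / lam) * g x"
      using convex_combination[of "1 / lam" 0 x] lam by simp
    also have "\<dots> \<le> (1 - 1 / lam) * t + (1 / lam) * t"
      using lam t that by (intro add_mono mult_left_mono) auto
    also have "\<dots> = t" by (simp add: algebra_simps)
    finally show ?thesis .
  qed
  have "x = lam *\<^sub>R ((1 / lam) *\<^sub>R x)" for x :: 'a using lam by simp
  thus ?thesis using shrink unfolding sandwiched_def by blast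
qed

lemma eventually_exp_less:
  assumes "k > 0" "e > (0::real)"
  shows "\<forall>\<^sub>F t in at_top. exp (- (k * t)) < e"
  using eventually_gt_at_top[of "- ln e / k"]
proof eventually_elim
  case (elim t)
  hence "- (k * t) < ln e" using assms by (simp add: field_simps)
  thus ?case using assms by (metis exp_less_mono exp_ln)
qed

text \<open>
  With \<open>\<delta> = exp (- t)\<close>, the first hypothesis on the depth beats \<open>\<delta>\<close> as soon as
  \<open>exp (- (1 - 1 / lam) * t) < c\<close>, and the second stays below \<open>\<delta>\<close> as soon as
  \<open>C * exp (- (\<kappa> - 1) * t) < 1\<close>.
\<close>

lemma eventually_sandwiched:
  assumes dep: "level_comparable dep" and lam: "lam > 1"
  shows "\<forall>\<^sub>F t in at_top. sandwiched lam t {x. ennreal (exp (- t)) \<le> dep x}"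
proof -
  obtain c where c: "c > 0" "\<And>t x. g (lam *\<^sub>R x) \<le> t \<Longrightarrow> ennreal (c * exp (- (t / lam))) \<le> dep x"
    using dep lam unfolding level_comparable_def by blast
  obtain \<kappa> C where C: "\<kappa> > 1" "C \<ge> 0"
    "\<And>t x. g 0 \<le> t \<Longrightarrow> g ((1 / lam) *\<^sub>R x) > t \<Longrightarrow> dep x \<le> ennreal (C * exp (- (\<kappa> * t)))"
    using dep lam unfolding level_comparable_def by metis
  have "\<forall>\<^sub>F t in at_top. exp (- ((1 - 1 / lam) * t)) < c"
    using lam c(1) by (intro eventually_exp_less) auto
  moreover have "\<forall>\<^sub>F t in at_top. exp (- ((\<kappa> - 1) * t)) < 1 / (C + 1)"
    using C by (intro eventually_exp_less) auto
  moreover have "\<forall>\<^sub>F t in at_top. g 0 \<le> t" by (rule eventually_ge_at_top)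
  ultimately show ?thesis
  proof eventually_elim
    case (elim t)
    have inside: "ennreal (exp (- t)) \<le> dep ((1 / lam) *\<^sub>R x)" if "g x \<le> t" for x
    proof -
      have "exp (- t) = exp (- ((1 - 1 / lam) * t)) * exp (- (t / lam))"
        unfolding exp_add[symmetric] by (simp add: algebra_simps)
      also have "\<dots> \<le> c * exp (- (t / lam))" using elim(1) by (intro mult_right_mono) auto
      finally have "ennreal (exp (- t)) \<le> ennreal (c * exp (- (t / lam)))" by (rule ennreal_leI)
      also have "\<dots> \<le> dep ((1 / lam) *\<^sub>R x)" using that lam by (intro c(2)) simp
      finally show ?thesis .
    qed
    have outside: "g ((1 / lam) *\<^sub>R x) \<le> t" if "ennreal (exp (- t)) \<le> dep x" for x
    proof (rule ccontr)
      assume "\<not> g ((1 / lam) *\<^sub>R x) \<le> t"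
      hence "dep x \<le> ennreal (C * exp (- (\<kappa> * t)))" using elim(3) by (intro C(3)) auto
      with that have "ennreal (exp (- t)) \<le> ennreal (C * exp (- (\<kappa> * t)))" by (rule order_trans)
      hence "exp (- t) \<le> C * exp (- (\<kappa> * t))" using C(2) by (simp add: ennreal_le_iff)
      also have "\<dots> = (C * exp (- ((\<kappa> - 1) * t))) * exp (- t)"
        by (simp add: algebra_simps flip: exp_add)
      finally have "1 \<le> C * exp (- ((\<kappa> - 1) * t))" by simp
      also have "\<dots> \<le> C * (1 / (C + 1))" using elim(2) C(2) by (intro mult_left_mono) auto
      also have "\<dots> < 1" using C(2) by simp
      finally show False by simp
    qed
    have "x = lam *\<^sub>R ((1 / lam) *\<^sub>R x)" for x :: 'a using lam by simp
    thus ?case using inside outside unfolding sandwiched_def by blast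
  qed
qed

text \<open>
  Shrinking by \<open>lam\<close> takes the outer dilate into the sublevel set and shrinking by \<open>lam\<close> again
  takes this into the inner one, hence the square. The condition on \<open>t\<close> makes the sublevel set a
  neighbourhood of the origin, which is therefore an admissible centre.
\<close>

lemma log_hausdorff_dist_sandwiched:
  assumes lam: "lam > 1" and t: "g 0 + 1 \<le> t"
    and K: "sandwiched lam t K" and L: "sandwiched lam t L"
  shows "log_hausdorff_dist K L \<le> ereal (lam\<^sup>2)"
proof -
  obtain r where r: "r > 0" "\<And>z. norm z \<le> r \<Longrightarrow> g z \<le> g 0 + 1"
    by (rule bounded_near_0) blast
  have scaled: "(1 / lam\<^sup>2) *\<^sub>R y \<in> B" if "y \<in> A" "sandwiched lam t A" "sandwiched lam t B" for y A B
  proof -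
    have "y \<in> (*\<^sub>R) lam ` {x. g x \<le> t}" using that(1,2) by (auto simp: sandwiched_def)
    then obtain x where x: "g x \<le> t" "y = lam *\<^sub>R x" by blast
    have "(1 / lam\<^sup>2) *\<^sub>R y = (1 / lam) *\<^sub>R x" using lam x by (simp add: power2_eq_square)
    thus ?thesis using that(3) x(1) by (auto simp: sandwiched_def)
  qed
  have ball: "ball 0 (r / lam) \<subseteq> A" if "sandwiched lam t A" for A
  proof
    fix y :: 'a assume "y \<in> ball 0 (r / lam)"
    hence "norm (lam *\<^sub>R y) \<le> r" using lam by (simp add: field_simps)
    hence "g (lam *\<^sub>R y) \<le> t" using r(2) t by fastforce
    moreover have "y = (1 / lam) *\<^sub>R (lam *\<^sub>R y)" using lam by simp
    ultimately show "y \<in> A" using that unfolding sandwiched_def by blast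
  qed
  have "0 \<in> interior (K \<inter> L)"
    unfolding mem_interior using ball[OF K] ball[OF L] r lam by (intro exI[of _ "r / lam"]) auto
  moreover have "(\<lambda>y. inverse (lam\<^sup>2) *\<^sub>R (y - 0) + 0) ` L \<subseteq> K"
    using scaled[OF _ L K] by (auto simp: inverse_eq_divide)
  moreover have "K \<subseteq> (\<lambda>y. lam\<^sup>2 *\<^sub>R (y - 0) + 0) ` L"
  proof
    fix y assume "y \<in> K"
    hence "(1 / lam\<^sup>2) *\<^sub>R y \<in> L" by (rule scaled[OF _ K L])
    moreover have "y = lam\<^sup>2 *\<^sub>R ((1 / lam\<^sup>2) *\<^sub>R y - 0) + 0" using lam by simp
    ultimately show "y \<in> (\<lambda>y. lam\<^sup>2 *\<^sub>R (y - 0) + 0) ` L" by (rule rev_image_eqI)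
  qed
  moreover have "lam\<^sup>2 \<ge> 1" using lam by simp
  ultimately show ?thesis unfolding log_hausdorff_dist_def by (intro Inf_lower) blast
qed

end

lemma log_hausdorff_dist_ge_1: "1 \<le> log_hausdorff_dist K L"
  unfolding log_hausdorff_dist_def by (rule Inf_greatest) (auto simp: one_ereal_def)

lemma (in integrable_potential) log_hausdorff_dist_tendsto_1:
  assumes "\<And>lam. lam > 1 \<Longrightarrow> \<forall>\<^sub>F t in at_top. sandwiched lam t (K (exp (- t)))"
    and "\<And>lam. lam > 1 \<Longrightarrow> \<forall>\<^sub>F t in at_top. sandwiched lam t (L (exp (- t)))"
  shows "((\<lambda>\<delta>. log_hausdorff_dist (K \<delta>) (L \<delta>)) \<longlongrightarrow> 1) (at_right 0)"
proof (rule order_tendstoI)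
  fix a :: ereal assume "a < 1"
  thus "\<forall>\<^sub>F \<delta> in at_right 0. a < log_hausdorff_dist (K \<delta>) (L \<delta>)"
    using log_hausdorff_dist_ge_1 by (intro always_eventually allI) (rule less_le_trans)
next
  fix a :: ereal assume "1 < a"
  then obtain y where y: "1 < y" "ereal y < a"
    using ereal_dense2[of 1 a] by (auto simp: one_ereal_def)
  define lam where "lam = sqrt y"
  have lam: "lam > 1" "lam\<^sup>2 = y" using y by (auto simp: lam_def)
  have "\<forall>\<^sub>F t in at_top. g 0 + 1 \<le> t" by (rule eventually_ge_at_top)
  with assms[OF lam(1)] have "\<forall>\<^sub>F t in at_top. log_hausdorff_dist (K (exp (- t))) (L (exp (- t))) < a"
  proof eventually_elim
    case (elim t)
    have "log_hausdorff_dist (K (exp (- t))) (L (exp (- t))) \<le> ereal (lam\<^sup>2)"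
      by (rule log_hausdorff_dist_sandwiched[OF lam(1) elim(3,1,2)])
    also have "\<dots> < a" using y lam by simp
    finally show ?case .
  qed
  moreover have "filterlim (\<lambda>\<delta>. - ln \<delta>) at_top (at_right (0::real))"
    using ln_at_0 by (simp add: filterlim_uminus_at_bot)
  ultimately have "\<forall>\<^sub>F \<delta> in at_right 0. log_hausdorff_dist (K (exp (- (- ln \<delta>)))) (L (exp (- (- ln \<delta>)))) < a"
    by (rule eventually_compose_filterlim)
  thus "\<forall>\<^sub>F \<delta> in at_right 0. log_hausdorff_dist (K \<delta>) (L \<delta>) < a"
    using eventually_at_right_less[of "0::real"] by eventually_elim simp
qed

theorem theorem3:
  fixes \<mu> :: "(real ^ 'n) measure" and f :: "real ^ 'n \<Rightarrow> real"
  assumes "prob_space \<mu>"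
    and "\<mu> = density lborel (\<lambda>x. ennreal (f x))"
    and "continuous_on UNIV f"
    and "\<forall>x. f x \<noteq> 0"
    and "log_concave f"
  shows "((\<lambda>\<delta>. log_hausdorff_dist (F_set \<mu> \<delta>) (D_set f \<delta>)) \<longlongrightarrow> 1) (at_right 0) \<and>
         ((\<lambda>\<delta>. log_hausdorff_dist (F_set \<mu> \<delta>) (R_set f \<delta>)) \<longlongrightarrow> 1) (at_right 0)"
proof -
  obtain S g where Sg: "convex_on S g" "f = (\<lambda>x. if x \<in> S then exp (- g x) else 0)"
    using assms(5) unfolding log_concave_def by blast
  have "S = UNIV" using assms(4) Sg(2) by (metis UNIV_eq_I)
  hence g: "convex_on UNIV g" "f = (\<lambda>x. exp (- g x))" using Sg by auto
  have "continuous_on UNIV (\<lambda>x. - ln (f x))" using assms(3,4) by (intro continuous_intros) auto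
  hence g_continuous: "continuous_on UNIV g" by (simp add: g(2))
  have [measurable]: "f \<in> borel_measurable borel"
    using assms(3) by (rule borel_measurable_continuous_onI)
  have "(\<integral>\<^sup>+ x. ennreal (f x) \<partial>lborel) = emeasure \<mu> (space \<mu>)"
    by (simp add: assms(2) emeasure_density)
  also have "\<dots> = 1" by (rule prob_space.emeasure_space_1[OF assms(1)])
  finally interpret integrable_potential g
    using g g_continuous by unfold_locales simp_all
  have F: "\<forall>\<^sub>F t in at_top. sandwiched lam t (F_set \<mu> (exp (- t)))" if "lam > 1" for lam
  proof -
    have ennreal_level: "halfspace_depth \<mu> x \<ge> exp (- t) \<longleftrightarrow> ennreal (exp (- t)) \<le> ennreal (halfspace_depth \<mu> x)" for x t
      by (auto simp: ennreal_le_iff2 not_le intro: order_trans[OF exp_ge_zero])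
    show ?thesis
      unfolding F_set_def ennreal_level unfolding assms(2) g(2)
      by (rule eventually_sandwiched[OF halfspace_depth_level_comparable that])
  qed
  have D: "\<forall>\<^sub>F t in at_top. sandwiched lam t (D_set f (exp (- t)))" if "lam > 1" for lam
    using eventually_ge_at_top[of "g 0"]
  proof eventually_elim
    case (elim t)
    show ?case unfolding D_set_def g(2)
      using sandwiched_closure[OF sandwiched_sublevel[OF that elim]] by simp
  qed
  have R: "\<forall>\<^sub>F t in at_top. sandwiched lam t (R_set f (exp (- t)))" if "lam > 1" for lam
    using eventually_sandwiched[OF hyperplane_depth_level_comparable that]
    unfolding R_set_def g(2) by eventually_elim (rule sandwiched_closure)
  show ?thesis
    using log_hausdorff_dist_tendsto_1[OF F D] log_hausdorff_dist_tendsto_1[OF F R] by blast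
qed

end
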